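(* For an integer $n\geq 2$, the following conditions are equivalent. (i) The involutory Cayley graph $\mathcal{G}(\mathbb{Z}_n[x])$ of $\mathbb{Z}_n[x]$ is bipartite. (ii) The involutory Cayley graph $\mathcal{G}(\mathbb{Z}_n)$ of $\mathbb{Z}_n$ is bipartite. (iii) $n$ is an even integer.
   Context: $\mathbb{Z}_n$ denotes the ring of integers modulo $n$. For a commutative ring $R$ with identity, the involutory Cayley graph $\mathcal{G}(R)$ is the simple undirected graph with vertex set $R$ in which two vertices $a,b$ are adjacent if and only if $(a-b)^2=1$. A graph is bipartite if its vertex set can be partitioned into two disjoint subsets such that every edge connects a vertex in one subset to a vertex in the other. *)

theory Defs
  imports
    "HOL-Number_Theory.Residues"
    "HOL-Algebra.UnivPoly"
    "Graph_Theory.Pair_Digraph"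
begin

text \<open>
  Undirected graphs are symmetric loop-free digraphs, as in Graph_Theory; since the vertex set
  may be infinite, the appropriate locale is \<^locale>\<open>pair_bidirected_digraph\<close> rather than
  \<^locale>\<open>pair_graph\<close>. The condition \<open>a \<noteq> b\<close> only has an effect in the zero ring.
\<close>

definition involutory_cayley_graph :: "('a, 'm) ring_scheme \<Rightarrow> 'a pair_pre_digraph" where
  "involutory_cayley_graph R =
     \<lparr> pverts = carrier R,
       parcs = {(a, b). a \<in> carrier R \<and> b \<in> carrier R \<and> a \<noteq> b \<and>
                  (a \<ominus>\<^bsub>R\<^esub> b) [^]\<^bsub>R\<^esub> (2::nat) = \<one>\<^bsub>R\<^esub>} \<rparr>"

lemma (in cring) involutory_cayley_graph_bidirected:
  "pair_bidirected_digraph (involutory_cayley_graph R)"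
proof -
  have "(b \<ominus> a) [^] (2::nat) = (a \<ominus> b) [^] (2::nat)"
    if "a \<in> carrier R" "b \<in> carrier R" for a b
  proof -
    have "b \<ominus> a = \<ominus> (a \<ominus> b)"
      using that by (simp add: a_minus_def minus_add a_comm)
    then show ?thesis
      using that by (simp add: numeral_2_eq_2 l_minus r_minus)
  qed
  then show ?thesis
    by unfold_locales (auto simp: involutory_cayley_graph_def symmetric_def sym_def)
qed

definition bipartite :: "'a pair_pre_digraph \<Rightarrow> bool" where
  "bipartite G \<longleftrightarrow>
     (\<exists>U V. pverts G = U \<union> V \<and> U \<inter> V = {} \<and> parcs G \<subseteq> U \<times> V \<union> V \<times> U)"

end

theory Submission
  imports Defs
begin

text \<open>
  A ring homomorphism into a nontrivial ring preserves the equation \<open>(a - b)\<^sup>2 = 1\<close>, and it cannot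
  identify \<open>a\<close> with \<open>b\<close> when this equation holds, since otherwise \<open>0 = 1\<close>. So it is a homomorphism of
  involutory Cayley graphs, and a 2-colouring of the target graph pulls back to the source
  (\<open>bipartite_pullback_ring_hom\<close>). For every nontrivial commutative ring \<open>R\<close> there are homomorphisms
  in both directions between \<open>R\<close> and \<open>R[x]\<close>: the inclusion of the constants and the evaluation at
  \<open>0\<close>. Hence \<open>\<G>(R)\<close> and \<open>\<G>(R[x])\<close> are bipartite simultaneously
  (\<open>bipartite_UP_iff\<close>).

  For \<open>\<int>\<^sub>n\<close> itself, if \<open>n\<close> is even, then parity is well defined modulo \<open>n\<close>, and a difference whose
  square is \<open>1\<close> is odd, so parity is a 2-colouring. If \<open>n\<close> is odd, then \<open>0, 1, \<dots>, n - 1, 0\<close> is a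
  closed walk of odd length in the graph, which excludes a 2-colouring.
\<close>

text \<open>
  The preimages of the two colour classes colour \<open>G\<close>. A \<^typ>\<open>'a pair_pre_digraph\<close> may have arcs
  whose endpoints are not vertices, so the second condition on \<open>f\<close> also asks for the endpoints.
\<close>

lemma bipartite_pullback:
  assumes "bipartite H"
    and verts: "\<And>a. a \<in> pverts G \<Longrightarrow> f a \<in> pverts H"
    and arcs: "\<And>a b. (a, b) \<in> parcs G \<Longrightarrow>
      a \<in> pverts G \<and> b \<in> pverts G \<and> (f a, f b) \<in> parcs H"
  shows "bipartite G"
proof -
  obtain U V where UV: "pverts H = U \<union> V" "U \<inter> V = {}" "parcs H \<subseteq> U \<times> V \<union> V \<times> U"
    using assms(1) unfolding bipartite_def by blast
  define U' where "U' = {a \<in> pverts G. f a \<in> U}"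
  define V' where "V' = {a \<in> pverts G. f a \<in> V}"
  have "pverts G = U' \<union> V'"
    using verts UV(1) unfolding U'_def V'_def by blast
  moreover have "U' \<inter> V' = {}"
    using UV(2) unfolding U'_def V'_def by blast
  moreover have "parcs G \<subseteq> U' \<times> V' \<union> V' \<times> U'"
  proof
    fix e
    assume e: "e \<in> parcs G"
    obtain a b where ab: "e = (a, b)"
      by fastforce
    then have "a \<in> pverts G" "b \<in> pverts G" "(f a, f b) \<in> U \<times> V \<union> V \<times> U"
      using arcs[of a b] e UV(3) by auto
    then show "e \<in> U' \<times> V' \<union> V' \<times> U'"
      unfolding ab U'_def V'_def by simp
  qed
  ultimately show ?thesis
    unfolding bipartite_def by blast
qed

text \<open>
  Nontriviality of \<open>S\<close> cannot be dropped: the graph of the zero ring is a single vertex without arcs,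
  and every ring has a homomorphism to the zero ring, while \<open>\<G>(\<int>\<^sub>3)\<close>, for example, is a triangle.
\<close>

lemma bipartite_pullback_ring_hom:
  assumes "ring_hom_cring R S h"
    and nontrivial: "\<one>\<^bsub>S\<^esub> \<noteq> \<zero>\<^bsub>S\<^esub>"
    and "bipartite (involutory_cayley_graph S)"
  shows "bipartite (involutory_cayley_graph R)"
proof -
  interpret h: ring_hom_cring R S h by fact
  show ?thesis
  proof (rule bipartite_pullback[OF assms(3), where f = h])
    fix a b
    assume "(a, b) \<in> parcs (involutory_cayley_graph R)"
    then have ab: "a \<in> carrier R" "b \<in> carrier R"
      and sq: "(a \<ominus>\<^bsub>R\<^esub> b) [^]\<^bsub>R\<^esub> (2::nat) = \<one>\<^bsub>R\<^esub>"
      by (auto simp: involutory_cayley_graph_def)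
    have "(h a \<ominus>\<^bsub>S\<^esub> h b) [^]\<^bsub>S\<^esub> (2::nat) = h ((a \<ominus>\<^bsub>R\<^esub> b) [^]\<^bsub>R\<^esub> (2::nat))"
      using ab by (simp add: a_minus_def numeral_2_eq_2)
    then have sq': "(h a \<ominus>\<^bsub>S\<^esub> h b) [^]\<^bsub>S\<^esub> (2::nat) = \<one>\<^bsub>S\<^esub>"
      using sq by simp
    \<comment> \<open>Equal images would give \<open>0\<^sup>2 = 1\<close> in \<open>S\<close>, so no arc is contracted.\<close>
    moreover have "h a \<noteq> h b"
      using sq' ab nontrivial by (auto simp: a_minus_def numeral_2_eq_2 h.S.r_neg)
    ultimately show "a \<in> pverts (involutory_cayley_graph R) \<and>
        b \<in> pverts (involutory_cayley_graph R) \<and>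
        (h a, h b) \<in> parcs (involutory_cayley_graph S)"
      using ab by (simp add: involutory_cayley_graph_def)
  qed (simp add: involutory_cayley_graph_def)
qed

lemma (in cring) bipartite_UP_iff:
  assumes nontrivial: "\<one> \<noteq> \<zero>"
  shows "bipartite (involutory_cayley_graph (UP R)) \<longleftrightarrow> bipartite (involutory_cayley_graph R)"
proof
  interpret UP_cring R "UP R"
    by unfold_locales
  have inclusion: "ring_hom_cring R (UP R) (\<lambda>a. monom (UP R) a 0)"
    by unfold_locales (rule const_ring_hom)
  have "coeff (UP R) \<one>\<^bsub>UP R\<^esub> 0 \<noteq> coeff (UP R) \<zero>\<^bsub>UP R\<^esub> 0"
    using nontrivial by simp
  then have "\<one>\<^bsub>UP R\<^esub> \<noteq> \<zero>\<^bsub>UP R\<^esub>"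
    by metis
  then show "bipartite (involutory_cayley_graph R)"
    if "bipartite (involutory_cayley_graph (UP R))"
    using bipartite_pullback_ring_hom[OF inclusion] that by blast
next
  interpret UP_pre_univ_prop R R id "UP R"
    by unfold_locales (auto intro!: ring_hom_memI)
  have "ring_hom_cring (UP R) R (eval R R id \<zero>)"
    by unfold_locales (simp add: eval_ring_hom)
  then show "bipartite (involutory_cayley_graph (UP R))"
    if "bipartite (involutory_cayley_graph R)"
    using bipartite_pullback_ring_hom nontrivial that by blast
qed

lemma (in residues) res_diff_square_eq_one_iff:
  "(a \<ominus> b) [^] (2::nat) = \<one> \<longleftrightarrow> (a - b)\<^sup>2 mod m = 1"
proof -
  have "a \<ominus> b = (a - b) mod m"
    by (simp add: a_minus_def res_add_eq res_neg_eq mod_simps)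
  then show ?thesis
    by (simp add: numeral_2_eq_2 res_mult_eq res_one_eq mod_simps)
qed

lemma (in residues) bipartite_residue_ring_if_even:
  assumes "even m"
  shows "bipartite (involutory_cayley_graph R)"
proof -
  have "even a \<noteq> even b"
    if "(a \<ominus> b) [^] (2::nat) = \<one>" for a b
  proof -
    have "(a - b)\<^sup>2 mod m = 1"
      using that res_diff_square_eq_one_iff by blast
    then have "odd ((a - b)\<^sup>2 mod m)"
      by simp
    \<comment> \<open>Here the parity of \<open>m\<close> enters: reduction modulo \<open>m\<close> preserves parity.\<close>
    then have "odd ((a - b)\<^sup>2)"
      using assms dvd_mod_iff by blast
    then show ?thesis
      by simp
  qed
  then have "parcs (involutory_cayley_graph R) \<subseteq>
      {a \<in> carrier R. even a} \<times> {a \<in> carrier R. odd a} \<union>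
      {a \<in> carrier R. odd a} \<times> {a \<in> carrier R. even a}"
    by (auto simp: involutory_cayley_graph_def)
  moreover have "pverts (involutory_cayley_graph R) =
      {a \<in> carrier R. even a} \<union> {a \<in> carrier R. odd a}"
    by (auto simp: involutory_cayley_graph_def)
  ultimately show ?thesis
    unfolding bipartite_def by blast
qed

text \<open>
  Consecutive residues are adjacent because \<open>1\<^sup>2 = 1\<close>, so the colour of \<open>k mod m\<close> alternates with
  \<open>k\<close>. The walk is indexed by natural numbers, which includes its closing step from \<open>m - 1\<close> to \<open>0\<close>.
\<close>

lemma (in residues) even_if_bipartite_residue_ring:
  assumes "bipartite (involutory_cayley_graph R)"
  shows "even m"
proof -
  obtain U V where UV: "carrier R = U \<union> V" "U \<inter> V = {}"
    and arcs: "parcs (involutory_cayley_graph R) \<subseteq> U \<times> V \<union> V \<times> U"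
    using assms unfolding bipartite_def by (auto simp: involutory_cayley_graph_def)
  have step: "(int (Suc k) mod m \<in> U) \<noteq> (int k mod m \<in> U)" for k
  proof -
    have diff: "(int (Suc k) mod m - int k mod m) mod m = 1"
      using m_gt_one by (simp add: mod_diff_eq)
    then have sq: "(int (Suc k) mod m - int k mod m)\<^sup>2 mod m = 1"
      using m_gt_one by (subst power_mod[symmetric]) simp
    have "int (Suc k) mod m \<noteq> int k mod m"
      using diff by auto
    then have "(int (Suc k) mod m, int k mod m) \<in> parcs (involutory_cayley_graph R)"
      using sq m_gt_one
      by (simp add: involutory_cayley_graph_def res_diff_square_eq_one_iff res_carrier_eq)
    then show ?thesis
      using arcs UV(2) by blast
  qed
  have alternate: "int k mod m \<in> U \<longleftrightarrow> (even k \<longleftrightarrow> 0 \<in> U)" for k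
  proof (induction k)
    case (Suc k)
    then show ?case
      using step[of k] even_Suc[of k] by blast
  qed simp
  \<comment> \<open>The residues at \<open>k = 0\<close> and \<open>k = m\<close> coincide, so the \<open>m\<close> colour changes in between cancel.\<close>
  have "even (nat m)"
    using alternate[of "nat m"] m_gt_one by (cases "0 \<in> U") auto
  then show ?thesis
    using m_gt_one by (simp add: even_nat_iff)
qed

theorem theorem3p3:
  fixes n :: int
  assumes "n \<ge> 2"
  shows "(bipartite (involutory_cayley_graph (UP (residue_ring n))) \<longleftrightarrow>
            bipartite (involutory_cayley_graph (residue_ring n))) \<and>
         (bipartite (involutory_cayley_graph (residue_ring n)) \<longleftrightarrow> even n)"
proof -
  interpret residues n "residue_ring n"
    using assms by unfold_locales auto
  have "\<one>\<^bsub>residue_ring n\<^esub> \<noteq> \<zero>\<^bsub>residue_ring n\<^esub>"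
    by (simp add: res_zero_eq res_one_eq)
  then show ?thesis
    using bipartite_UP_iff bipartite_residue_ring_if_even even_if_bipartite_residue_ring by blast
qed

end
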